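(* Suppose that $G$ is a Hausdorff topological group of semisimple type and $K$ is a closed normal subgroup of $G$. Then $G/K$ is of semisimple type, and $G/\mathrm{Z}(G)$ is of strict semisimple type.
   Context: For a topological group $G$ and a subset $M\subseteq G$, write $\overline{\langle\langle M\rangle\rangle_G}$ for the smallest closed normal subgroup of $G$ containing $M$. A component of $G$ is a closed subgroup $M$ of $G$ such that: (a) $M$ is normal in $\overline{\langle\langle M\rangle\rangle_G}$; (b) $M/\mathrm{Z}(M)$ is non-abelian; (c) whenever $K$ is a proper closed normal subgroup of $M$, then $K$ is central in $\overline{\langle\langle M\rangle\rangle_G}$. The layer $E(G)$ is the closed subgroup of $G$ generated by all components of $G$ (trivial if there are none). $G$ is of semisimple type if $G=E(G)$, and of strict semisimple type if in addition $\mathrm{Z}(G)=\{1\}$. *)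

theory Defs
  imports "HOL-Algebra.Coset" "HOL-Analysis.T1_Spaces"
begin

locale topological_group = group G for G (structure) +
  fixes T :: "'a topology"
  assumes topspace_eq_carrier: "topspace T = carrier G"
    and continuous_mult: "continuous_map (prod_topology T T) T (\<lambda>(x, y). x \<otimes> y)"
    and continuous_inv: "continuous_map T T (\<lambda>x. inv x)"

definition group_center :: "('a, 'b) monoid_scheme \<Rightarrow> 'a set" where
  "group_center G = {z \<in> carrier G. \<forall>x\<in>carrier G. z \<otimes>\<^bsub>G\<^esub> x = x \<otimes>\<^bsub>G\<^esub> z}"

definition closed_normal_closure ::
  "('a, 'b) monoid_scheme \<Rightarrow> 'a topology \<Rightarrow> 'a set \<Rightarrow> 'a set" where
  "closed_normal_closure G T M = (\<lambda>N. N \<lhd> G \<and> closedin T N) hull M"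

definition closed_generate ::
  "('a, 'b) monoid_scheme \<Rightarrow> 'a topology \<Rightarrow> 'a set \<Rightarrow> 'a set" where
  "closed_generate G T S = (\<lambda>H. subgroup H G \<and> closedin T H) hull S"

definition component_of_group ::
  "('a, 'b) monoid_scheme \<Rightarrow> 'a topology \<Rightarrow> 'a set \<Rightarrow> bool" where
  "component_of_group G T M \<longleftrightarrow>
     subgroup M G \<and> closedin T M \<and>
     M \<lhd> G\<lparr>carrier := closed_normal_closure G T M\<rparr> \<and>
     \<not> comm_group (G\<lparr>carrier := M\<rparr> Mod group_center (G\<lparr>carrier := M\<rparr>)) \<and>
     (\<forall>K. K \<lhd> G\<lparr>carrier := M\<rparr> \<and> closedin (subtopology T M) K \<and> K \<noteq> M \<longrightarrow>
          K \<subseteq> group_center (G\<lparr>carrier := closed_normal_closure G T M\<rparr>))"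

(* With no components this is the closure of the identity, i.e. trivial when T is Hausdorff. *)
definition layer :: "('a, 'b) monoid_scheme \<Rightarrow> 'a topology \<Rightarrow> 'a set" where
  "layer G T = closed_generate G T (\<Union>{M. component_of_group G T M})"

definition semisimple_type :: "('a, 'b) monoid_scheme \<Rightarrow> 'a topology \<Rightarrow> bool" where
  "semisimple_type G T \<longleftrightarrow> topological_group G T \<and> layer G T = carrier G"

definition strict_semisimple_type :: "('a, 'b) monoid_scheme \<Rightarrow> 'a topology \<Rightarrow> bool" where
  "strict_semisimple_type G T \<longleftrightarrow> semisimple_type G T \<and> group_center G = {\<one>\<^bsub>G\<^esub>}"

definition quotient_group_topology ::
  "('a, 'b) monoid_scheme \<Rightarrow> 'a topology \<Rightarrow> 'a set \<Rightarrow> 'a set topology" where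
  "quotient_group_topology G T K =
     topology (\<lambda>U. U \<subseteq> carrier (G Mod K) \<and> openin T {x \<in> carrier G. K #>\<^bsub>G\<^esub> x \<in> U})"

lemma openin_quotient_group_topology:
  assumes "topspace T = carrier G"
  shows "openin (quotient_group_topology G T K) U \<longleftrightarrow>
         U \<subseteq> carrier (G Mod K) \<and> openin T {x \<in> carrier G. K #>\<^bsub>G\<^esub> x \<in> U}"
proof -
  let ?P = "\<lambda>x U. K #>\<^bsub>G\<^esub> x \<in> U"
  have Int: "{x \<in> carrier G. ?P x (U \<inter> V)} = {x \<in> carrier G. ?P x U} \<inter> {x \<in> carrier G. ?P x V}"
    for U V by auto
  have Un: "{x \<in> carrier G. ?P x (\<Union>\<K>)} = (\<Union>U\<in>\<K>. {x \<in> carrier G. ?P x U})" for \<K>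
    by auto
  have "istopology (\<lambda>U. U \<subseteq> carrier (G Mod K) \<and> openin T {x \<in> carrier G. ?P x U})"
    unfolding istopology_def Int Un by (auto intro!: openin_Int openin_Union)
  then show ?thesis
    unfolding quotient_group_topology_def by (simp add: topology_inverse')
qed

lemma quotient_map_quotient_group_topology:
  assumes "topspace T = carrier G"
  shows "quotient_map T (quotient_group_topology G T K) (\<lambda>x. K #>\<^bsub>G\<^esub> x)"
proof -
  let ?Q = "quotient_group_topology G T K"
  have img: "(\<lambda>x. K #>\<^bsub>G\<^esub> x) ` carrier G = carrier (G Mod K)"
    by (auto simp: FactGroup_def RCOSETS_def)
  have "{x \<in> carrier G. K #>\<^bsub>G\<^esub> x \<in> carrier (G Mod K)} = topspace T"
    using img assms by auto
  then have "openin ?Q (carrier (G Mod K))"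
    unfolding openin_quotient_group_topology[OF assms] by (simp del: mem_Collect_eq)
  then have "topspace ?Q = carrier (G Mod K)"
    using openin_quotient_group_topology[OF assms, of K "topspace ?Q"]
    by (auto dest: openin_subset)
  then show ?thesis
    using assms img by (simp add: quotient_map_def openin_quotient_group_topology)
qed

end

theory Submission
  imports Defs
begin

text \<open>Let \<open>M\<close> be a component of \<open>G\<close> with closed normal closure \<open>N\<close>. Everything rests on one
  commutator argument (\<open>commutator_mem_centralizer\<close>): if \<open>[r, M]\<close> is abelian and centralizes
  \<open>M\<close>, then \<open>m \<mapsto> [r, m]\<close> is a homomorphism into an abelian group, so \<open>r\<close> centralizes
  \<open>[M, M]\<close>. In a Hausdorff group centralizers are closed, and the commutators of \<open>M\<close> generate
  \<open>M\<close> topologically (\<open>M_topologically_perfect\<close>); hence \<open>r\<close> centralizes \<open>M\<close>. Minimality of the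
  component supplies such situations: a proper closed normal subgroup of \<open>M\<close> is central in \<open>N\<close>.
  This gives two dichotomies. A closed normal subgroup \<open>K\<close> of \<open>G\<close> contains \<open>M\<close> or centralizes
  \<open>N\<close> (\<open>closed_normal_dichotomy\<close>), and each conjugate of \<open>M\<close> lies in \<open>M\<close> or commutes with it
  (\<open>conjugate_dichotomy\<close>).

  Now pass to \<open>G / K\<close>. If \<open>M \<subseteq> K\<close>, the image of \<open>M\<close> is trivial. Otherwise its closure, which is
  \<open>P / K\<close> with \<open>P\<close> the closure of \<open>M K\<close>, is a component of \<open>G / K\<close>
  (\<open>component_proj_P\<close>). The main point is minimality. Let \<open>K \<subseteq> R \<subset> P\<close> with \<open>R\<close> closed and
  normal in \<open>P\<close>. Then \<open>R \<inter> M\<close> is proper in \<open>M\<close>, hence central in \<open>N\<close>. It contains \<open>[R, M]\<close>,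
  because \<open>K\<close> centralizes \<open>M\<close> and so \<open>P\<close> normalizes \<open>M\<close>. Therefore \<open>R\<close> centralizes \<open>M\<close>; the
  conjugates of \<open>M\<close> not contained in \<open>M\<close> commute with \<open>M\<close> and \<open>K\<close>, hence with \<open>P\<close>. So \<open>R\<close>
  centralizes \<open>N\<close>, and \<open>R / K\<close> is central in the closure of \<open>N K / K\<close>. The layer of \<open>G / K\<close>
  thus contains the images of all components of \<open>G\<close>, and these generate \<open>G / K\<close> topologically.

  For the center, let \<open>r\<close> be central modulo \<open>Z(G)\<close>. All \<open>[r, m]\<close> are central, so the commutator
  argument shows that \<open>r\<close> centralizes every component, and then the closed subgroup \<open>G\<close> that
  they generate.\<close>

section \<open>Conjugation and commutators\<close>

context group
begin

definition conj_by :: "'a \<Rightarrow> 'a \<Rightarrow> 'a" where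
  "conj_by g x = g \<otimes> x \<otimes> inv g"

definition commutator :: "'a \<Rightarrow> 'a \<Rightarrow> 'a" where
  "commutator x y = x \<otimes> y \<otimes> inv x \<otimes> inv y"

lemma conj_by_closed [simp]:
  "\<lbrakk>g \<in> carrier G; x \<in> carrier G\<rbrakk> \<Longrightarrow> conj_by g x \<in> carrier G"
  by (simp add: conj_by_def)

lemma commutator_closed [simp]:
  "\<lbrakk>x \<in> carrier G; y \<in> carrier G\<rbrakk> \<Longrightarrow> commutator x y \<in> carrier G"
  by (simp add: commutator_def)

lemma cancel_left:
  assumes "x \<in> carrier G" "y \<in> carrier G"
  shows "inv x \<otimes> (x \<otimes> y) = y" "x \<otimes> (inv x \<otimes> y) = y"
  using assms by (simp_all flip: m_assoc)

text \<open>Together with the definitions of the two operations, these rules rewrite every group word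
  to its freely reduced form, so they decide identities between words in commutators and
  conjugates.\<close>

lemmas word_simps = m_assoc inv_mult_group cancel_left conj_by_def commutator_def

lemma commutator_eq_one_iff:
  assumes "x \<in> carrier G" "y \<in> carrier G"
  shows "commutator x y = \<one> \<longleftrightarrow> x \<otimes> y = y \<otimes> x"
proof -
  have "commutator x y = (x \<otimes> y) \<otimes> inv (y \<otimes> x)"
    using assms by (simp add: word_simps)
  then show ?thesis
    using assms by (metis inv_equality inv_inv m_closed inv_closed r_inv)
qed

lemma conj_by_mem_subgroup:
  "\<lbrakk>subgroup H G; g \<in> H; x \<in> H\<rbrakk> \<Longrightarrow> conj_by g x \<in> H"
  by (simp add: conj_by_def subgroup.m_closed subgroup.m_inv_closed)

lemma commutator_mem_subgroup:
  "\<lbrakk>subgroup H G; x \<in> H; y \<in> H\<rbrakk> \<Longrightarrow> commutator x y \<in> H"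
  by (simp add: commutator_def subgroup.m_closed subgroup.m_inv_closed)

lemma commutator_swap_mem:
  assumes "subgroup H G" "x \<in> carrier G" "y \<in> carrier G" "commutator x y \<in> H"
  shows "commutator y x \<in> H"
proof -
  have "commutator y x = inv (commutator x y)"
    using assms by (simp add: word_simps)
  then show ?thesis
    using assms by (simp add: subgroup.m_inv_closed)
qed

lemma normal_iff_conj_by:
  "H \<lhd> G \<longleftrightarrow> subgroup H G \<and> (\<forall>g\<in>carrier G. \<forall>h\<in>H. conj_by g h \<in> H)"
  by (simp add: normal_inv_iff conj_by_def)

lemma commutator_mem_normal:
  assumes "H \<lhd> G" "x \<in> H" "y \<in> carrier G"
  shows "commutator x y \<in> H"
proof -
  have H: "subgroup H G" and "conj_by y (inv x) \<in> H"
    using assms by (auto simp: normal_iff_conj_by subgroup.m_inv_closed)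
  moreover have "x \<in> carrier G"
    using H assms by (simp add: subgroup.mem_carrier)
  then have "commutator x y = x \<otimes> conj_by y (inv x)"
    using assms by (simp add: word_simps)
  ultimately show ?thesis
    using assms by (simp add: subgroup.m_closed)
qed

lemma normal_in_subgroup_iff:
  assumes S: "subgroup S G"
  shows "H \<lhd> G\<lparr>carrier := S\<rparr> \<longleftrightarrow>
    subgroup H G \<and> H \<subseteq> S \<and> (\<forall>s\<in>S. \<forall>h\<in>H. conj_by s h \<in> H)"
proof -
  interpret S: group "G\<lparr>carrier := S\<rparr>"
    using S by (rule subgroup_imp_group)
  have "subgroup H (G\<lparr>carrier := S\<rparr>) \<longleftrightarrow> subgroup H G \<and> H \<subseteq> S"
    using S incl_subgroup[OF S, of H] subgroup_incl[of H S] subgroup.subset[of H "G\<lparr>carrier := S\<rparr>"]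
    by auto
  then show ?thesis
    using S unfolding S.normal_inv_iff by (auto simp: conj_by_def)
qed

lemma mem_center_subgroup_iff:
  assumes "subgroup S G"
  shows "z \<in> group_center (G\<lparr>carrier := S\<rparr>) \<longleftrightarrow> z \<in> S \<and> (\<forall>s\<in>S. commutator z s = \<one>)"
  using subgroup.mem_carrier[OF assms] by (auto simp: group_center_def commutator_eq_one_iff)

text \<open>The preimage of the centralizer of the image of \<open>S\<close> in the quotient by \<open>K\<close>; for
  \<open>K = {\<one>}\<close> it is the centralizer of \<open>S\<close>.\<close>

definition centralizer_mod :: "'a set \<Rightarrow> 'a set \<Rightarrow> 'a set" where
  "centralizer_mod K S = {x \<in> carrier G. \<forall>s\<in>S. commutator x s \<in> K}"

lemma subgroup_centralizer_mod:
  assumes K: "K \<lhd> G" and S: "S \<subseteq> carrier G"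
  shows "subgroup (centralizer_mod K S) G"
proof (rule subgroupI)
  have KG: "subgroup K G" and conj: "\<And>g k. \<lbrakk>g \<in> carrier G; k \<in> K\<rbrakk> \<Longrightarrow> conj_by g k \<in> K"
    using K by (auto simp: normal_iff_conj_by)
  show "centralizer_mod K S \<subseteq> carrier G"
    by (auto simp: centralizer_mod_def)
  have "commutator \<one> s \<in> K" if "s \<in> S" for s
    using that S subgroup.one_closed[OF KG] by (auto simp: word_simps)
  then show "centralizer_mod K S \<noteq> {}"
    by (auto simp: centralizer_mod_def)
  show "inv x \<in> centralizer_mod K S" if "x \<in> centralizer_mod K S" for x
  proof -
    have "commutator (inv x) s \<in> K" if "s \<in> S" for s
    proof -
      have "x \<in> carrier G" "s \<in> carrier G" "commutator x s \<in> K"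
        using \<open>x \<in> _\<close> \<open>s \<in> S\<close> S by (auto simp: centralizer_mod_def)
      moreover from this have "commutator (inv x) s = conj_by (inv x) (inv (commutator x s))"
        by (simp add: word_simps)
      ultimately show ?thesis
        using conj KG by (simp add: subgroup.m_inv_closed)
    qed
    with that show ?thesis
      by (auto simp: centralizer_mod_def)
  qed
  show "x \<otimes> y \<in> centralizer_mod K S"
    if "x \<in> centralizer_mod K S" "y \<in> centralizer_mod K S" for x y
  proof -
    have "commutator (x \<otimes> y) s \<in> K" if "s \<in> S" for s
    proof -
      have "x \<in> carrier G" "y \<in> carrier G" "s \<in> carrier G" "commutator x s \<in> K" "commutator y s \<in> K"
        using \<open>x \<in> _\<close> \<open>y \<in> _\<close> \<open>s \<in> S\<close> S by (auto simp: centralizer_mod_def)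
      moreover from this
      have "commutator (x \<otimes> y) s = conj_by x (commutator y s) \<otimes> commutator x s"
        by (simp add: word_simps)
      ultimately show ?thesis
        using conj KG by (simp add: subgroup.m_closed)
    qed
    with that show ?thesis
      by (auto simp: centralizer_mod_def)
  qed
qed

abbreviation centralizer :: "'a set \<Rightarrow> 'a set" where
  "centralizer S \<equiv> centralizer_mod {\<one>} S"

lemma subgroup_centralizer:
  "S \<subseteq> carrier G \<Longrightarrow> subgroup (centralizer S) G"
  by (intro subgroup_centralizer_mod one_is_normal)

lemma centralizer_sym:
  assumes "A \<subseteq> carrier G" "B \<subseteq> carrier G"
  shows "A \<subseteq> centralizer B \<longleftrightarrow> B \<subseteq> centralizer A"
  using assms commutator_swap_mem[OF triv_subgroup]
  by (auto simp: centralizer_mod_def subset_iff)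

definition normalizer :: "'a set \<Rightarrow> 'a set" where
  "normalizer H = {g \<in> carrier G. \<forall>h\<in>H. conj_by g h \<in> H \<and> conj_by (inv g) h \<in> H}"

lemma subgroup_normalizer:
  assumes "H \<subseteq> carrier G"
  shows "subgroup (normalizer H) G"
proof (rule subgroupI)
  show "normalizer H \<subseteq> carrier G"
    by (auto simp: normalizer_def)
  have "conj_by \<one> h = h" if "h \<in> H" for h
    using that assms by (auto simp: word_simps)
  then show "normalizer H \<noteq> {}"
    by (auto simp: normalizer_def)
  show "inv g \<in> normalizer H" if "g \<in> normalizer H" for g
    using that by (auto simp: normalizer_def)
  show "a \<otimes> b \<in> normalizer H" if "a \<in> normalizer H" "b \<in> normalizer H" for a b
  proof -
    have ab: "a \<in> carrier G" "b \<in> carrier G"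
      using that by (auto simp: normalizer_def)
    have "conj_by (a \<otimes> b) h = conj_by a (conj_by b h)"
      "conj_by (inv (a \<otimes> b)) h = conj_by (inv b) (conj_by (inv a) h)" if "h \<in> H" for h
      using that ab assms by (auto simp: word_simps)
    then show ?thesis
      using that by (simp add: normalizer_def)
  qed
qed

lemma subgroup_subset_normalizerI:
  assumes "subgroup A G" "\<And>a h. \<lbrakk>a \<in> A; h \<in> H\<rbrakk> \<Longrightarrow> conj_by a h \<in> H"
  shows "A \<subseteq> normalizer H"
  using assms by (auto simp: normalizer_def subgroup.m_inv_closed subgroup.mem_carrier)

text \<open>If all \<open>[r, m]\<close> with \<open>m \<in> M\<close> lie in an abelian set centralizing \<open>M\<close>, then
  \<open>m \<mapsto> [r, m]\<close> is a homomorphism from \<open>M\<close> to an abelian group. Hence it kills the commutators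
  of \<open>M\<close>. This is the case of the three subgroup lemma on which all later arguments rest.\<close>

lemma commutator_mem_centralizer:
  assumes M: "subgroup M G" and r: "r \<in> carrier G"
    and cent: "\<And>m. m \<in> M \<Longrightarrow> commutator r m \<in> centralizer M"
    and abel: "\<And>m m'. \<lbrakk>m \<in> M; m' \<in> M\<rbrakk> \<Longrightarrow> commutator (commutator r m) (commutator r m') = \<one>"
    and x: "x \<in> M" and y: "y \<in> M"
  shows "commutator x y \<in> centralizer {r}"
proof -
  have carr: "m \<in> carrier G" if "m \<in> M" for m
    using M that by (simp add: subgroup.mem_carrier)
  have mult: "commutator r (m \<otimes> m') = commutator r m \<otimes> commutator r m'"
    if m: "m \<in> M" and m': "m' \<in> M" for m m'
  proof -
    have "commutator r m' \<otimes> m = m \<otimes> commutator r m'"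
      using cent[OF m'] m r carr[OF m] carr[OF m']
      by (auto simp: centralizer_mod_def commutator_eq_one_iff)
    then have "conj_by m (commutator r m') = commutator r m'"
      using r carr[OF m] carr[OF m']
      by (metis conj_by_def commutator_closed inv_solve_right m_closed)
    moreover have "commutator r (m \<otimes> m') = commutator r m \<otimes> conj_by m (commutator r m')"
      using r carr[OF m] carr[OF m'] by (simp add: word_simps)
    ultimately show ?thesis
      by simp
  qed
  define c u v where "c = commutator r (x \<otimes> y)" and "u = x \<otimes> y" and "v = y \<otimes> x"
  have uv: "u \<in> M" "v \<in> M"
    using M x y by (auto simp: u_def v_def subgroup.m_closed)
  then have uv': "u \<in> carrier G" "v \<in> carrier G" and c: "c \<in> carrier G"
    using carr r by (auto simp: c_def u_def)
  have cu: "commutator r u = c"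
    by (simp add: c_def u_def)
  have cv: "commutator r v = c"
    using mult[OF x y] mult[OF y x] abel[OF x y] r carr[OF x] carr[OF y]
    by (simp add: c_def v_def commutator_eq_one_iff)
  have w: "commutator x y = u \<otimes> inv v"
    using carr[OF x] carr[OF y] by (simp add: u_def v_def word_simps)
  have "u \<otimes> inv v \<in> M"
    using M uv by (simp add: subgroup.m_closed subgroup.m_inv_closed)
  then have comm: "c \<otimes> (u \<otimes> inv v) = (u \<otimes> inv v) \<otimes> c"
    using cent[OF uv(1)] c uv' unfolding cu
    by (auto simp: centralizer_mod_def commutator_eq_one_iff)
  have "conj_by r (u \<otimes> inv v) = (commutator r u \<otimes> u) \<otimes> inv (commutator r v \<otimes> v)"
    using r uv' by (simp add: word_simps)
  also have "\<dots> = (c \<otimes> (u \<otimes> inv v)) \<otimes> inv c"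
    unfolding cu cv using c uv' by (simp add: word_simps)
  also have "\<dots> = u \<otimes> inv v"
    unfolding comm using c uv' by (simp add: word_simps)
  finally have "(u \<otimes> inv v) \<otimes> r = r \<otimes> (u \<otimes> inv v)"
    using r uv' by (metis conj_by_def inv_solve_right m_closed inv_closed)
  then show ?thesis
    using r uv' by (simp add: centralizer_mod_def w commutator_eq_one_iff)
qed

lemma group_center_eq: "group_center G = centralizer (carrier G)"
  by (auto simp: group_center_def centralizer_mod_def commutator_eq_one_iff)

lemma normal_group_center: "group_center G \<lhd> G"
proof -
  have "conj_by g z = z" if "g \<in> carrier G" "z \<in> group_center G" for g z
    using that by (auto simp: group_center_def conj_by_def m_assoc) (metis inv_closed m_assoc r_inv r_one)
  then show ?thesis
    using subgroup_centralizer_mod[OF one_is_normal, of "carrier G"]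
    by (simp add: normal_iff_conj_by group_center_eq)
qed

end

lemma (in normal) comm_group_Mod_iff:
  "comm_group (G Mod H) \<longleftrightarrow> (\<forall>x\<in>carrier G. \<forall>y\<in>carrier G. commutator x y \<in> H)"
proof -
  interpret Q: group "G Mod H"
    by (rule factorgroup_is_group)
  have comm: "H #> x \<otimes> y = H #> y \<otimes> x \<longleftrightarrow> commutator x y \<in> H"
    if xy: "x \<in> carrier G" "y \<in> carrier G" for x y
  proof -
    have eq: "commutator x y = (x \<otimes> y) \<otimes> inv (y \<otimes> x)"
      using xy by (simp add: word_simps)
    show ?thesis
    proof
      assume "H #> x \<otimes> y = H #> y \<otimes> x"
      then have "H #> ((x \<otimes> y) \<otimes> inv (y \<otimes> x)) = H"
        using xy subset by (intro coset_mult_inv2) auto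
      then show "commutator x y \<in> H"
        using coset_join1[OF _ _ is_subgroup] xy unfolding eq by simp
    next
      assume "commutator x y \<in> H"
      then have "H #> ((x \<otimes> y) \<otimes> inv (y \<otimes> x)) = H"
        using coset_join2[OF _ is_subgroup] xy unfolding eq by simp
      then show "H #> x \<otimes> y = H #> y \<otimes> x"
        using xy subset by (intro coset_mult_inv1) auto
    qed
  qed
  have "comm_group (G Mod H) \<longleftrightarrow> (\<forall>X\<in>carrier (G Mod H). \<forall>Y\<in>carrier (G Mod H). X <#> Y = Y <#> X)"
  proof
    assume "comm_group (G Mod H)"
    then show "\<forall>X\<in>carrier (G Mod H). \<forall>Y\<in>carrier (G Mod H). X <#> Y = Y <#> X"
      using comm_groupE(4)[of "G Mod H"] by simp
  qed (rule Q.group_comm_groupI, simp)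
  also have "\<dots> \<longleftrightarrow> (\<forall>x\<in>carrier G. \<forall>y\<in>carrier G. H #> x \<otimes> y = H #> y \<otimes> x)"
    unfolding carrier_FactGroup by (force simp: rcos_sum)
  finally show ?thesis
    using comm by simp
qed

section \<open>Closed subgroups of topological groups\<close>

context topological_group
begin

lemma continuous_map_mult:
  assumes "continuous_map X T f" "continuous_map X T g"
  shows "continuous_map X T (\<lambda>x. f x \<otimes> g x)"
proof -
  have "continuous_map X (prod_topology T T) (\<lambda>x. (f x, g x))"
    using assms by (simp add: continuous_map_paired)
  from continuous_map_compose[OF this continuous_mult] show ?thesis
    by (simp add: comp_def)
qed

lemma continuous_map_inverse:
  "continuous_map X T f \<Longrightarrow> continuous_map X T (\<lambda>x. inv f x)"
  using continuous_map_compose[OF _ continuous_inv] by (simp add: comp_def)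

lemma continuous_map_constant:
  "c \<in> carrier G \<Longrightarrow> continuous_map X T (\<lambda>x. c)"
  by (simp add: topspace_eq_carrier)

lemmas continuous_intros_group =
  continuous_map_mult continuous_map_inverse continuous_map_constant continuous_map_id[unfolded id_def]

lemma closedin_Collect_ball:
  assumes "\<And>s. s \<in> S \<Longrightarrow> continuous_map T T (f s)" and "closedin T C"
  shows "closedin T {x \<in> carrier G. \<forall>s\<in>S. f s x \<in> C}"
proof (cases "S = {}")
  case True
  then show ?thesis
    using closedin_topspace[of T] by (simp add: topspace_eq_carrier)
next
  case False
  have "closedin T (\<Inter>s\<in>S. {x \<in> topspace T. f s x \<in> C})"
    using False assms by (intro closedin_INT closedin_continuous_map_preimage) auto
  also have "(\<Inter>s\<in>S. {x \<in> topspace T. f s x \<in> C}) = {x \<in> carrier G. \<forall>s\<in>S. f s x \<in> C}"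
    using False by (auto simp: topspace_eq_carrier)
  finally show ?thesis .
qed

lemma closedin_centralizer_mod:
  assumes "closedin T K" "S \<subseteq> carrier G"
  shows "closedin T (centralizer_mod K S)"
  unfolding centralizer_mod_def commutator_def
  using assms by (intro closedin_Collect_ball continuous_intros_group) auto

lemma closedin_centralizer:
  assumes "Hausdorff_space T" "S \<subseteq> carrier G"
  shows "closedin T (centralizer S)"
  using assms
  by (intro closedin_centralizer_mod closedin_Hausdorff_singleton) (auto simp: topspace_eq_carrier)

lemma closedin_normalizer:
  assumes "closedin T H"
  shows "closedin T (normalizer H)"
proof -
  have H: "H \<subseteq> carrier G"
    using closedin_subset[OF assms] by (simp add: topspace_eq_carrier)
  have "normalizer H = {g \<in> carrier G. \<forall>h\<in>H. conj_by g h \<in> H} \<inter>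
      {g \<in> carrier G. \<forall>h\<in>H. conj_by (inv g) h \<in> H}"
    by (auto simp: normalizer_def)
  moreover have "closedin T {g \<in> carrier G. \<forall>h\<in>H. conj_by g h \<in> H}"
    "closedin T {g \<in> carrier G. \<forall>h\<in>H. conj_by (inv g) h \<in> H}"
    unfolding conj_by_def
    using assms H by (intro closedin_Collect_ball continuous_intros_group; auto)+
  ultimately show ?thesis
    by (simp add: closedin_Int)
qed

definition conj_preimage :: "'a \<Rightarrow> 'a set \<Rightarrow> 'a set" where
  "conj_preimage g H = {x \<in> carrier G. conj_by g x \<in> H}"

lemma subgroup_conj_preimage:
  assumes g: "g \<in> carrier G" and H: "subgroup H G"
  shows "subgroup (conj_preimage g H) G"
proof (rule subgroupI)
  have "conj_by g \<one> = \<one>"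
    using g by (simp add: word_simps)
  then show "conj_preimage g H \<noteq> {}"
    using subgroup.one_closed[OF H] by (auto simp: conj_preimage_def)
  show "conj_preimage g H \<subseteq> carrier G"
    by (auto simp: conj_preimage_def)
  show "inv x \<in> conj_preimage g H" if "x \<in> conj_preimage g H" for x
  proof -
    have "conj_by g (inv x) = inv (conj_by g x)"
      using g that by (simp add: conj_preimage_def word_simps)
    then show ?thesis
      using that subgroup.m_inv_closed[OF H] by (simp add: conj_preimage_def)
  qed
  show "x \<otimes> y \<in> conj_preimage g H" if "x \<in> conj_preimage g H" "y \<in> conj_preimage g H" for x y
  proof -
    have "conj_by g (x \<otimes> y) = conj_by g x \<otimes> conj_by g y"
      using g that by (simp add: conj_preimage_def word_simps)
    then show ?thesis
      using that subgroup.m_closed[OF H] by (simp add: conj_preimage_def)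
  qed
qed

lemma closedin_conj_preimage:
  assumes "g \<in> carrier G" "closedin T H"
  shows "closedin T (conj_preimage g H)"
proof -
  have "continuous_map T T (conj_by g)"
    unfolding conj_by_def using assms by (intro continuous_intros_group) auto
  then show ?thesis
    using assms closedin_continuous_map_preimage[of T T "conj_by g" H]
    by (simp add: conj_preimage_def topspace_eq_carrier)
qed

lemma closed_generate_least:
  "\<lbrakk>subgroup H G; closedin T H; S \<subseteq> H\<rbrakk> \<Longrightarrow> closed_generate G T S \<subseteq> H"
  unfolding closed_generate_def by (rule hull_minimal) auto

lemma closed_generate_superset: "S \<subseteq> closed_generate G T S"
  unfolding closed_generate_def by (rule hull_subset)

lemma closedin_carrier: "closedin T (carrier G)"
  using closedin_topspace[of T] by (simp add: topspace_eq_carrier)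

lemma
  assumes "S \<subseteq> carrier G"
  shows subgroup_closed_generate: "subgroup (closed_generate G T S) G"
    and closedin_closed_generate: "closedin T (closed_generate G T S)"
proof -
  have "carrier G \<in> {H. (subgroup H G \<and> closedin T H) \<and> S \<subseteq> H}"
    using assms subgroup_self closedin_carrier by simp
  then show "subgroup (closed_generate G T S) G" "closedin T (closed_generate G T S)"
    unfolding closed_generate_def hull_def
    by (intro subgroups_Inter closedin_Inter; blast)+
qed

lemma conj_by_closed_generate:
  assumes S: "S \<subseteq> carrier G" and g: "g \<in> carrier G"
    and conj: "\<And>s. s \<in> S \<Longrightarrow> conj_by g s \<in> closed_generate G T S"
    and h: "h \<in> closed_generate G T S"
  shows "conj_by g h \<in> closed_generate G T S"
proof -
  have "closed_generate G T S \<subseteq> conj_preimage g (closed_generate G T S)"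
    using assms subgroup_closed_generate[OF S] closedin_closed_generate[OF S]
    by (intro closed_generate_least subgroup_conj_preimage closedin_conj_preimage)
      (auto simp: conj_preimage_def)
  with h show ?thesis
    by (auto simp: conj_preimage_def)
qed

lemma closed_normal_closure_least:
  "\<lbrakk>H \<lhd> G; closedin T H; M \<subseteq> H\<rbrakk> \<Longrightarrow> closed_normal_closure G T M \<subseteq> H"
  unfolding closed_normal_closure_def by (rule hull_minimal) auto

lemma closed_normal_closure_superset: "M \<subseteq> closed_normal_closure G T M"
  unfolding closed_normal_closure_def by (rule hull_subset)

lemma normal_carrier: "carrier G \<lhd> G"
  using subgroup_self by (simp add: normal_iff_conj_by)

lemma
  assumes "M \<subseteq> carrier G"
  shows normal_closed_normal_closure: "closed_normal_closure G T M \<lhd> G"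
    and closedin_closed_normal_closure: "closedin T (closed_normal_closure G T M)"
proof -
  let ?F = "{H. (H \<lhd> G \<and> closedin T H) \<and> M \<subseteq> H}"
  have F: "carrier G \<in> ?F"
    using assms normal_carrier closedin_carrier by simp
  have "subgroup (\<Inter>?F) G"
    using F by (intro subgroups_Inter) (auto simp: normal_iff_conj_by)
  then show "closed_normal_closure G T M \<lhd> G"
    unfolding closed_normal_closure_def hull_def normal_iff_conj_by by blast
  show "closedin T (closed_normal_closure G T M)"
    unfolding closed_normal_closure_def hull_def using F by (intro closedin_Inter) blast+
qed

text \<open>A closed normal closure is topologically generated by conjugates: for a closed subgroup
  \<open>H\<close> that contains them all, the intersection of the conjugates of \<open>H\<close> is closed and normal.\<close>

lemma closed_normal_closure_subset_subgroup:
  assumes H: "subgroup H G" "closedin T H" and M: "M \<subseteq> carrier G"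
    and conj: "\<And>g m. \<lbrakk>g \<in> carrier G; m \<in> M\<rbrakk> \<Longrightarrow> conj_by g m \<in> H"
  shows "closed_normal_closure G T M \<subseteq> H"
proof -
  define C where "C = (\<Inter>g\<in>carrier G. conj_preimage g H)"
  have "subgroup C G"
    unfolding C_def using H by (intro subgroups_Inter) (auto intro: subgroup_conj_preimage)
  moreover have "conj_by g x \<in> C" if g: "g \<in> carrier G" and x: "x \<in> C" for g x
  proof -
    have x': "x \<in> carrier G"
      using x by (auto simp: C_def conj_preimage_def)
    have "conj_by h (conj_by g x) \<in> H" if h: "h \<in> carrier G" for h
    proof -
      have "conj_by h (conj_by g x) = conj_by (h \<otimes> g) x"
        using g h x' by (simp add: word_simps)
      moreover have "x \<in> conj_preimage (h \<otimes> g) H"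
        using g h x by (auto simp: C_def)
      ultimately show ?thesis
        by (simp add: conj_preimage_def)
    qed
    then show ?thesis
      using g x' by (simp add: C_def conj_preimage_def)
  qed
  ultimately have "C \<lhd> G"
    by (simp add: normal_iff_conj_by)
  moreover have "closedin T C"
    unfolding C_def using H by (intro closedin_INT closedin_conj_preimage) auto
  moreover have "M \<subseteq> C"
    using M conj by (auto simp: C_def conj_preimage_def)
  ultimately have "closed_normal_closure G T M \<subseteq> C"
    by (rule closed_normal_closure_least)
  moreover have "C \<subseteq> H"
  proof
    fix x assume "x \<in> C"
    then have "x \<in> conj_preimage \<one> H"
      by (auto simp: C_def)
    then show "x \<in> H"
      by (auto simp: conj_preimage_def conj_by_def)
  qed
  ultimately show ?thesis
    by blast
qed

text \<open>Being a component, in terms of commutators and conjugates in the ambient group. A quotient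
  by the center is abelian exactly when the group is nilpotent of class at most two, which turns
  the second condition into one on double commutators.\<close>

lemma component_of_group_iff:
  "component_of_group G T M \<longleftrightarrow>
     subgroup M G \<and> closedin T M \<and>
     (\<forall>n\<in>closed_normal_closure G T M. \<forall>m\<in>M. conj_by n m \<in> M) \<and>
     (\<exists>x\<in>M. \<exists>y\<in>M. \<exists>z\<in>M. commutator (commutator x y) z \<noteq> \<one>) \<and>
     (\<forall>K. subgroup K G \<and> closedin T K \<and> K \<subset> M \<and> (\<forall>m\<in>M. \<forall>k\<in>K. conj_by m k \<in> K) \<longrightarrow>
          K \<subseteq> centralizer (closed_normal_closure G T M))"
proof (cases "subgroup M G \<and> closedin T M")
  case True
  then have M: "subgroup M G" and Mc: "closedin T M"
    by auto
  define N where "N = closed_normal_closure G T M"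
  have MN: "M \<subseteq> N" and "N \<lhd> G"
    using normal_closed_normal_closure[of M] closed_normal_closure_superset[of M]
      subgroup.subset[OF M] by (auto simp: N_def)
  then have N: "subgroup N G"
    by (simp add: normal_iff_conj_by)
  interpret M: group "G\<lparr>carrier := M\<rparr>"
    using M by (rule subgroup_imp_group)
  interpret Z: normal "group_center (G\<lparr>carrier := M\<rparr>)" "G\<lparr>carrier := M\<rparr>"
    by (rule M.normal_group_center)
  have "M.commutator x y = commutator x y" if "x \<in> M" "y \<in> M" for x y
    using that M by (simp add: M.commutator_def commutator_def)
  then have b: "comm_group (G\<lparr>carrier := M\<rparr> Mod group_center (G\<lparr>carrier := M\<rparr>)) \<longleftrightarrow>
      (\<forall>x\<in>M. \<forall>y\<in>M. \<forall>z\<in>M. commutator (commutator x y) z = \<one>)"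
    using M by (auto simp: Z.comm_group_Mod_iff mem_center_subgroup_iff commutator_mem_subgroup)
  have c: "K \<lhd> G\<lparr>carrier := M\<rparr> \<and> closedin (subtopology T M) K \<and> K \<noteq> M \<longleftrightarrow>
      subgroup K G \<and> closedin T K \<and> K \<subset> M \<and> (\<forall>m\<in>M. \<forall>k\<in>K. conj_by m k \<in> K)" for K
    unfolding normal_in_subgroup_iff[OF M] closedin_closed_subtopology[OF Mc] by auto
  have d: "K \<subseteq> group_center (G\<lparr>carrier := N\<rparr>) \<longleftrightarrow> K \<subseteq> centralizer N"
    if "K \<subset> M" for K
    using that MN subgroup.subset[OF N]
    by (auto simp: mem_center_subgroup_iff[OF N] centralizer_mod_def subset_iff)
  show ?thesis
    unfolding component_of_group_def N_def[symmetric] normal_in_subgroup_iff[OF N] b c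
    using True MN d by auto
qed (auto simp: component_of_group_def)

end

section \<open>Components of Hausdorff groups\<close>

locale group_component = topological_group +
  fixes M
  assumes hausdorff [simp]: "Hausdorff_space T"
    and component: "component_of_group G T M"
begin

definition N where "N = closed_normal_closure G T M"

lemma subgroup_M: "subgroup M G"
  and closedin_M: "closedin T M"
  and conj_N_M: "\<lbrakk>n \<in> N; m \<in> M\<rbrakk> \<Longrightarrow> conj_by n m \<in> M"
  and not_nilpotent_M: "\<exists>x\<in>M. \<exists>y\<in>M. \<exists>z\<in>M. commutator (commutator x y) z \<noteq> \<one>"
  using component unfolding component_of_group_iff N_def by blast+

lemma small_subgroup_central:
  assumes "subgroup K G" "closedin T K" "K \<subseteq> M" "\<And>m k. \<lbrakk>m \<in> M; k \<in> K\<rbrakk> \<Longrightarrow> conj_by m k \<in> K"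
    and "K \<noteq> M"
  shows "K \<subseteq> centralizer N"
  using component assms unfolding component_of_group_iff N_def by blast

lemma M_subset_carrier: "M \<subseteq> carrier G"
  using subgroup_M by (rule subgroup.subset)

lemma normal_N: "N \<lhd> G" and M_subset_N: "M \<subseteq> N"
  unfolding N_def
  by (auto simp: M_subset_carrier normal_closed_normal_closure
      intro: closed_normal_closure_superset[THEN subsetD])

lemma subgroup_N: "subgroup N G"
  using normal_N by (simp add: normal_iff_conj_by)

lemma N_subset_carrier: "N \<subseteq> carrier G"
  using subgroup_N by (rule subgroup.subset)

lemma commutator_N_M:
  assumes "n \<in> N" "m \<in> M"
  shows "commutator n m \<in> M"
proof -
  have "commutator n m = conj_by n m \<otimes> inv m"
    by (simp add: commutator_def conj_by_def)
  then show ?thesis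
    using assms conj_N_M subgroup_M by (simp add: subgroup.m_closed subgroup.m_inv_closed)
qed

text \<open>A component is topologically perfect. Otherwise the intersection with a closed subgroup
  containing its commutators would be proper, closed and normal, hence central, and the component
  would be nilpotent of class at most two.\<close>

lemma M_topologically_perfect:
  assumes H: "subgroup H G" "closedin T H"
    and comm: "\<And>x y. \<lbrakk>x \<in> M; y \<in> M\<rbrakk> \<Longrightarrow> commutator x y \<in> H"
  shows "M \<subseteq> H"
proof (rule ccontr)
  assume "\<not> M \<subseteq> H"
  have "conj_by m k \<in> M \<inter> H" if m: "m \<in> M" and k: "k \<in> M \<inter> H" for m k
  proof -
    have "m \<in> carrier G" "k \<in> carrier G"
      using m k M_subset_carrier by auto
    then have "conj_by m k = commutator m k \<otimes> k"
      by (simp add: word_simps)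
    moreover have "commutator m k \<in> H"
      using m k by (intro comm) auto
    ultimately show ?thesis
      using m k H subgroup_M by (simp add: subgroup.m_closed commutator_mem_subgroup)
  qed
  then have "M \<inter> H \<subseteq> centralizer N"
    using \<open>\<not> M \<subseteq> H\<close> H subgroup_M closedin_M
    by (intro small_subgroup_central subgroups_Inter_pair closedin_Int) auto
  moreover have "commutator x y \<in> M \<inter> H" if "x \<in> M" "y \<in> M" for x y
    using that comm subgroup_M by (simp add: commutator_mem_subgroup)
  ultimately have "commutator (commutator x y) z = \<one>" if "x \<in> M" "y \<in> M" "z \<in> M" for x y z
    using that M_subset_N unfolding centralizer_mod_def by blast
  then show False
    using not_nilpotent_M by blast
qed

lemma mem_centralizer_M_if_commutators_central:
  assumes r: "r \<in> carrier G"
    and cent: "\<And>m. m \<in> M \<Longrightarrow> commutator r m \<in> centralizer M"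
    and abel: "\<And>m m'. \<lbrakk>m \<in> M; m' \<in> M\<rbrakk> \<Longrightarrow> commutator (commutator r m) (commutator r m') = \<one>"
  shows "r \<in> centralizer M"
proof -
  have "M \<subseteq> centralizer {r}"
  proof (rule M_topologically_perfect)
    show "subgroup (centralizer {r}) G" "closedin T (centralizer {r})"
      using r by (auto intro: subgroup_centralizer closedin_centralizer)
    show "commutator x y \<in> centralizer {r}" if "x \<in> M" "y \<in> M" for x y
      using subgroup_M r cent abel that by (rule commutator_mem_centralizer)
  qed
  then show ?thesis
    using centralizer_sym[of M "{r}"] M_subset_carrier r by auto
qed

text \<open>If \<open>r \<in> N\<close>, then \<open>[r, M] \<subseteq> M\<close>, so centrality in \<open>N\<close>, which is what the minimality of
  \<open>M\<close> provides, already makes \<open>[r, M]\<close> abelian.\<close>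

lemma mem_centralizer_M_if_commutators_in_center:
  assumes "r \<in> N" and "\<And>m. m \<in> M \<Longrightarrow> commutator r m \<in> centralizer N"
  shows "r \<in> centralizer M"
proof (rule mem_centralizer_M_if_commutators_central)
  show "r \<in> carrier G"
    using assms N_subset_carrier by blast
  show "commutator r m \<in> centralizer M" if "m \<in> M" for m
    using assms(2)[OF that] M_subset_N by (auto simp: centralizer_mod_def)
  show "commutator (commutator r m) (commutator r m') = \<one>" if "m \<in> M" "m' \<in> M" for m m'
    using assms(2)[OF that(1)] commutator_N_M[OF assms(1) that(2)] M_subset_N
    by (auto simp: centralizer_mod_def)
qed

lemma N_subset_centralizer:
  assumes S: "S \<subseteq> carrier G"
    and conj: "\<And>g m. \<lbrakk>g \<in> carrier G; m \<in> M\<rbrakk> \<Longrightarrow> conj_by g m \<in> centralizer S"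
  shows "N \<subseteq> centralizer S"
  unfolding N_def
  by (intro closed_normal_closure_subset_subgroup subgroup_centralizer closedin_centralizer
      hausdorff M_subset_carrier S conj)

text \<open>The centralizer of a normal subgroup contains with \<open>M\<close> all conjugates of \<open>M\<close>, which
  generate \<open>N\<close> topologically.\<close>

lemma normal_subset_centralizer_N:
  assumes K: "K \<lhd> G" and KM: "K \<subseteq> centralizer M"
  shows "K \<subseteq> centralizer N"
proof -
  have K_carrier: "K \<subseteq> carrier G"
    using K by (auto simp: normal_iff_conj_by dest: subgroup.subset)
  have "N \<subseteq> centralizer K"
  proof (rule N_subset_centralizer)
    show "conj_by g m \<in> centralizer K" if g: "g \<in> carrier G" and m: "m \<in> M" for g m
    proof -
      have "commutator (conj_by g m) k = \<one>" if k: "k \<in> K" for k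
      proof -
        have c: "k \<in> carrier G" "m \<in> carrier G"
          using k m K_carrier M_subset_carrier by auto
        have "conj_by (inv g) k \<in> centralizer M"
          using K g k KM by (auto simp: normal_iff_conj_by)
        then have "commutator m (conj_by (inv g) k) = \<one>"
          using m g c by (metis (no_types, lifting) centralizer_mod_def commutator_swap_mem conj_by_closed inv_closed mem_Collect_eq singletonD singletonI triv_subgroup)
        moreover have "commutator (conj_by g m) k = conj_by g (commutator m (conj_by (inv g) k))"
          using g c by (simp add: word_simps)
        ultimately show ?thesis
          using g by (simp add: conj_by_def)
      qed
      then show ?thesis
        using g m M_subset_carrier by (auto simp: centralizer_mod_def)
    qed
  qed (rule K_carrier)
  then show ?thesis
    using centralizer_sym K_carrier N_subset_carrier by blast
qed

text \<open>As \<open>K \<inter> M\<close> is proper in \<open>M\<close>, it is central in \<open>N\<close>. It contains \<open>[K \<inter> N, M]\<close>, so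
  \<open>K \<inter> N\<close> centralizes \<open>M\<close> and then \<open>N\<close>. In turn \<open>[K, M] \<subseteq> K \<inter> N\<close>, so the same step applies
  to \<open>K\<close> itself.\<close>

lemma closed_normal_dichotomy:
  assumes K: "K \<lhd> G" "closedin T K" and not_sub: "\<not> M \<subseteq> K"
  shows "K \<subseteq> centralizer N"
proof -
  have KG: "subgroup K G" and K_carrier: "K \<subseteq> carrier G"
    using K by (auto simp: normal_iff_conj_by dest: subgroup.subset)
  have "K \<inter> M \<subseteq> centralizer N"
  proof (rule small_subgroup_central)
    show "conj_by m k \<in> K \<inter> M" if "m \<in> M" "k \<in> K \<inter> M" for m k
      using that K M_subset_carrier subgroup_M by (auto simp: normal_iff_conj_by conj_by_mem_subgroup)
  qed (use not_sub KG K subgroup_M closedin_M in \<open>auto intro: subgroups_Inter_pair\<close>)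
  then have "K \<inter> N \<subseteq> centralizer M"
    using K M_subset_carrier commutator_N_M
    by (intro subsetI mem_centralizer_M_if_commutators_in_center) (auto intro: commutator_mem_normal)
  moreover have "K \<inter> N \<lhd> G"
    using K normal_N by (intro normal_subgroup_intersect)
  ultimately have KNN: "K \<inter> N \<subseteq> centralizer N"
    by (intro normal_subset_centralizer_N)
  have KM: "K \<subseteq> centralizer M"
  proof
    fix r assume r: "r \<in> K"
    have *: "commutator r m \<in> K \<inter> N" if "m \<in> M" for m
    proof -
      have c: "r \<in> carrier G" "m \<in> carrier G" "m \<in> N"
        using r that K_carrier M_subset_carrier M_subset_N by auto
      then have "commutator m r \<in> N"
        using normal_N by (intro commutator_mem_normal)
      then show ?thesis
        using c r K subgroup_N commutator_mem_normal commutator_swap_mem by blast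
    qed
    show "r \<in> centralizer M"
    proof (rule mem_centralizer_M_if_commutators_central)
      show "commutator r m \<in> centralizer M" if "m \<in> M" for m
        using *[OF that] KNN M_subset_N by (auto simp: centralizer_mod_def)
      show "commutator (commutator r m) (commutator r m') = \<one>" if "m \<in> M" "m' \<in> M" for m m'
        using *[OF that(1)] *[OF that(2)] KNN by (auto simp: centralizer_mod_def)
    qed (use r K_carrier in auto)
  qed
  show ?thesis
    using K KM by (intro normal_subset_centralizer_N)
qed

text \<open>The conjugates of \<open>M\<close> are normal in \<open>N\<close>. Unless conjugation by \<open>g\<close> carries \<open>M\<close> into
  itself, \<open>M\<close> meets the conjugate by the inverse of \<open>g\<close> in a proper, hence central, subgroup, and
  this intersection contains their mutual commutators. The proof works with that inverse conjugate
  because it is a preimage, so that it is visibly a closed subgroup.\<close>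

lemma conjugate_dichotomy:
  assumes g: "g \<in> carrier G"
  shows "conj_by g ` M \<subseteq> M \<or> conj_by g ` M \<subseteq> centralizer M"
proof (cases "M \<subseteq> conj_preimage g M")
  case True
  then show ?thesis
    by (auto simp: conj_preimage_def)
next
  case False
  define A where "A = conj_preimage g M"
  have A_N: "A \<subseteq> N"
  proof
    fix a assume a: "a \<in> A"
    then have "conj_by (inv g) (conj_by g a) \<in> N"
      using g normal_N M_subset_N by (auto simp: A_def conj_preimage_def normal_iff_conj_by)
    then show "a \<in> N"
      using a g by (simp add: A_def conj_preimage_def word_simps)
  qed
  have conj_A: "conj_by g m \<in> N" if "m \<in> M" for m
    using that g normal_N M_subset_N by (auto simp: normal_iff_conj_by)
  have MA: "M \<inter> A \<subseteq> centralizer N"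
  proof (rule small_subgroup_central)
    show "conj_by m k \<in> M \<inter> A" if m: "m \<in> M" and k: "k \<in> M \<inter> A" for m k
    proof -
      have "m \<in> carrier G" "k \<in> carrier G"
        using m k M_subset_carrier by auto
      then have "conj_by g (conj_by m k) = conj_by (conj_by g m) (conj_by g k)"
        using g by (simp add: word_simps)
      moreover have "conj_by (conj_by g m) (conj_by g k) \<in> M"
        using conj_A[OF m] k by (intro conj_N_M[OF conj_A[OF m]]) (auto simp: A_def conj_preimage_def)
      ultimately show ?thesis
        using g m k M_subset_carrier subgroup_M
        by (auto simp: A_def conj_preimage_def conj_by_mem_subgroup)
    qed
  qed (use False g subgroup_M closedin_M in \<open>auto simp: A_def
      intro: subgroups_Inter_pair subgroup_conj_preimage closedin_conj_preimage closedin_Int\<close>)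
  have A_M: "A \<subseteq> centralizer M"
  proof
    fix r assume r: "r \<in> A"
    show "r \<in> centralizer M"
    proof (rule mem_centralizer_M_if_commutators_in_center)
      show "commutator r m \<in> centralizer N" if m: "m \<in> M" for m
      proof -
        have c: "r \<in> carrier G" "m \<in> carrier G" and gr: "conj_by g r \<in> M"
          using r m M_subset_carrier by (auto simp: A_def conj_preimage_def)
        have "conj_by g (commutator r m) = commutator (conj_by g r) (conj_by g m)"
          using g c by (simp add: word_simps)
        also have "\<dots> = conj_by g r \<otimes> conj_by (conj_by g m) (inv (conj_by g r))"
          using g c by (simp add: word_simps)
        also have "\<dots> \<in> M"
          using subgroup.m_closed[OF subgroup_M gr]
            conj_N_M[OF conj_A[OF m] subgroup.m_inv_closed[OF subgroup_M gr]] by simp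
        finally have "commutator r m \<in> A"
          using c by (simp add: A_def conj_preimage_def)
        moreover have "commutator r m \<in> M"
          using r A_N m by (blast intro: commutator_N_M)
        ultimately show ?thesis
          using MA by auto
      qed
    qed (use r A_N in auto)
  qed
  have "commutator (conj_by g m') m = \<one>" if "m' \<in> M" "m \<in> M" for m m'
  proof -
    have c: "m \<in> carrier G" "m' \<in> carrier G"
      using that M_subset_carrier by auto
    have "conj_by g (conj_by (inv g) m) = m"
      using g c by (simp add: word_simps)
    then have "conj_by (inv g) m \<in> centralizer M"
      using A_M g c that by (auto simp: A_def conj_preimage_def)
    then have "commutator m' (conj_by (inv g) m) = \<one>"
      using that g c by (metis (no_types, lifting) centralizer_mod_def commutator_swap_mem conj_by_closed inv_closed mem_Collect_eq singletonD singletonI triv_subgroup)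
    moreover have "commutator (conj_by g m') m = conj_by g (commutator m' (conj_by (inv g) m))"
      using g c by (simp add: word_simps)
    ultimately show ?thesis
      using g by (simp add: conj_by_def)
  qed
  then show ?thesis
    using g M_subset_carrier by (auto simp: centralizer_mod_def)
qed

end

section \<open>Quotients by closed normal subgroups\<close>

lemma open_map_prod:
  assumes f: "open_map X X' f" and g: "open_map Y Y' g"
  shows "open_map (prod_topology X Y) (prod_topology X' Y') (\<lambda>(x, y). (f x, g y))"
  unfolding open_map_def
proof (intro allI impI)
  fix W assume W: "openin (prod_topology X Y) W"
  show "openin (prod_topology X' Y') ((\<lambda>(x, y). (f x, g y)) ` W)"
    unfolding openin_prod_topology_alt
  proof (intro allI impI)
    fix a b assume "(a, b) \<in> (\<lambda>(x, y). (f x, g y)) ` W"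
    then obtain x y where xy: "(x, y) \<in> W" "a = f x" "b = g y"
      by auto
    then obtain U V where "openin X U" "openin Y V" "x \<in> U" "y \<in> V" "U \<times> V \<subseteq> W"
      using W unfolding openin_prod_topology_alt by meson
    then show "\<exists>U V. openin X' U \<and> openin Y' V \<and> a \<in> U \<and> b \<in> V \<and>
        U \<times> V \<subseteq> (\<lambda>(x, y). (f x, g y)) ` W"
      using f g xy by (intro exI[of _ "f ` U"] exI[of _ "g ` V"]) (auto simp: open_map_def)
  qed
qed

(* Computations in the quotient go through the projection, not through products of cosets. *)
declare mult_FactGroup [simp del] one_FactGroup [simp del]

locale closed_normal_quotient = topological_group G T + normal K G
  for G (structure) and T :: "'a topology" and K +
  assumes closedin_K: "closedin T K"
begin

abbreviation Q where "Q \<equiv> G Mod K"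
abbreviation QT where "QT \<equiv> quotient_group_topology G T K"

definition proj :: "'a \<Rightarrow> 'a set" where "proj x = K #> x"

definition pre :: "'a set set \<Rightarrow> 'a set" where "pre B = {x \<in> carrier G. proj x \<in> B}"

lemma quotient_map_proj: "quotient_map T QT proj"
  using quotient_map_quotient_group_topology[OF topspace_eq_carrier, of K]
  by (simp add: proj_def[abs_def])

lemma carrier_Q: "carrier Q = proj ` carrier G"
  by (simp add: carrier_FactGroup proj_def[abs_def])

lemma topspace_QT: "topspace QT = carrier Q"
  using quotient_map_proj by (simp add: quotient_map_def topspace_eq_carrier carrier_Q)

lemma K_subset_carrier: "K \<subseteq> carrier G"
  by (rule subset)

lemma proj_eq_iff:
  assumes "x \<in> carrier G" "y \<in> carrier G"
  shows "proj x = proj y \<longleftrightarrow> (\<exists>k\<in>K. y = k \<otimes> x)"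
proof
  assume "proj x = proj y"
  then have "y \<in> K #> x"
    using rcos_self[OF assms(2) is_subgroup] by (simp add: proj_def)
  then show "\<exists>k\<in>K. y = k \<otimes> x"
    by (auto simp: r_coset_def)
next
  assume "\<exists>k\<in>K. y = k \<otimes> x"
  then have "y \<in> K #> x"
    by (auto simp: r_coset_def)
  then show "proj x = proj y"
    unfolding proj_def using repr_independence assms is_subgroup by blast
qed

text \<open>The saturation of a set is the union of its translates by elements of \<open>K\<close>, so the
  projection is open.\<close>

lemma open_map_proj: "open_map T QT proj"
  unfolding open_map_def
proof (intro allI impI)
  fix U assume U: "openin T U"
  have UG: "U \<subseteq> carrier G"
    using openin_subset[OF U] by (simp add: topspace_eq_carrier)
  have "openin T {x \<in> carrier G. k \<otimes> x \<in> U}" if "k \<in> K" for k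
  proof -
    have "continuous_map T T (\<lambda>x. k \<otimes> x)"
      using that K_subset_carrier by (intro continuous_intros_group) auto
    from openin_continuous_map_preimage[OF this U] show ?thesis
      by (simp add: topspace_eq_carrier)
  qed
  then have "openin T (\<Union>k\<in>K. {x \<in> carrier G. k \<otimes> x \<in> U})"
    by blast
  also have "(\<Union>k\<in>K. {x \<in> carrier G. k \<otimes> x \<in> U}) = {x \<in> carrier G. K #> x \<in> proj ` U}"
    using proj_eq_iff UG by (fastforce simp: proj_def[symmetric])
  finally show "openin QT (proj ` U)"
    using UG by (auto simp: openin_quotient_group_topology[OF topspace_eq_carrier] carrier_Q)
qed

lemma proj_mult: "\<lbrakk>x \<in> carrier G; y \<in> carrier G\<rbrakk> \<Longrightarrow> proj x \<otimes>\<^bsub>Q\<^esub> proj y = proj (x \<otimes> y)"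
  by (simp add: proj_def rcos_sum mult_FactGroup)

lemma proj_in_carrier [simp]: "x \<in> carrier G \<Longrightarrow> proj x \<in> carrier Q"
  by (simp add: carrier_Q)

lemma proj_inv: "x \<in> carrier G \<Longrightarrow> inv\<^bsub>Q\<^esub> (proj x) = proj (inv x)"
  using proj_in_carrier[of x] by (simp add: inv_FactGroup) (simp add: proj_def rcos_inv)

lemma proj_eq_one_iff: "x \<in> carrier G \<Longrightarrow> proj x = \<one>\<^bsub>Q\<^esub> \<longleftrightarrow> x \<in> K"
  using coset_join1[OF _ _ is_subgroup] coset_join2[OF _ is_subgroup]
  by (auto simp: proj_def FactGroup_def)

sublocale Q: topological_group Q QT
proof -
  interpret Q: group Q
    by (rule factorgroup_is_group)
  have continuous_proj: "continuous_map T QT proj"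
    using quotient_map_proj by (rule quotient_imp_continuous_map)
  have "continuous_map (prod_topology QT QT) QT (\<lambda>(X, Y). X \<otimes>\<^bsub>Q\<^esub> Y)"
  proof (rule continuous_compose_quotient_map)
    let ?pp = "\<lambda>(x, y). (proj x, proj y)"
    show "quotient_map (prod_topology T T) (prod_topology QT QT) ?pp"
    proof (rule continuous_open_imp_quotient_map)
      show "continuous_map (prod_topology T T) (prod_topology QT QT) ?pp"
        using continuous_proj by (simp add: continuous_map_prod_top)
      show "open_map (prod_topology T T) (prod_topology QT QT) ?pp"
        using open_map_proj open_map_proj by (rule open_map_prod)
      show "?pp ` topspace (prod_topology T T) = topspace (prod_topology QT QT)"
        unfolding topspace_prod_topology topspace_eq_carrier topspace_QT carrier_Q by force
    qed
    have "continuous_map (prod_topology T T) QT (proj \<circ> (\<lambda>(x, y). x \<otimes> y))"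
      using continuous_mult continuous_proj by (rule continuous_map_compose)
    then show "continuous_map (prod_topology T T) QT ((\<lambda>(X, Y). X \<otimes>\<^bsub>Q\<^esub> Y) \<circ> ?pp)"
      by (rule continuous_map_eq) (auto simp: topspace_eq_carrier proj_mult)
  qed
  moreover have "continuous_map QT QT (\<lambda>X. inv\<^bsub>Q\<^esub> X)"
  proof (rule continuous_compose_quotient_map[OF quotient_map_proj])
    have "continuous_map T QT (proj \<circ> (\<lambda>x. inv x))"
      using continuous_inv continuous_proj by (rule continuous_map_compose)
    then show "continuous_map T QT ((\<lambda>X. inv\<^bsub>Q\<^esub> X) \<circ> proj)"
      by (rule continuous_map_eq) (auto simp: topspace_eq_carrier proj_inv)
  qed
  ultimately show "topological_group Q QT"
    by unfold_locales (auto simp: topspace_QT)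
qed

lemma proj_conj_by:
  "\<lbrakk>g \<in> carrier G; x \<in> carrier G\<rbrakk> \<Longrightarrow> Q.conj_by (proj g) (proj x) = proj (conj_by g x)"
  unfolding Q.conj_by_def conj_by_def by (simp add: proj_mult proj_inv)

lemma proj_commutator:
  "\<lbrakk>x \<in> carrier G; y \<in> carrier G\<rbrakk> \<Longrightarrow> Q.commutator (proj x) (proj y) = proj (commutator x y)"
  unfolding Q.commutator_def commutator_def
  by (simp add: proj_mult proj_inv)

lemma subgroup_pre:
  assumes "subgroup B Q"
  shows "subgroup (pre B) G"
proof (rule subgroupI)
  show "pre B \<noteq> {}"
    using subgroup.one_closed[OF assms] proj_eq_one_iff[of \<one>] by (auto simp: pre_def)
  show "inv x \<in> pre B" if "x \<in> pre B" for x
    using that subgroup.m_inv_closed[OF assms, of "proj x"] by (auto simp: pre_def proj_inv)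
  show "x \<otimes> y \<in> pre B" if "x \<in> pre B" "y \<in> pre B" for x y
    using that subgroup.m_closed[OF assms, of "proj x" "proj y"]
    by (auto simp: pre_def proj_mult)
qed (auto simp: pre_def)

lemma closedin_pre: "closedin QT B \<Longrightarrow> closedin T (pre B)"
  using closedin_continuous_map_preimage[OF quotient_imp_continuous_map[OF quotient_map_proj]]
  by (simp add: pre_def topspace_eq_carrier)

lemma K_subset_pre: "subgroup B Q \<Longrightarrow> K \<subseteq> pre B"
proof
  fix k assume B: "subgroup B Q" and k: "k \<in> K"
  then have "k \<in> carrier G" "proj k = \<one>\<^bsub>Q\<^esub>"
    using K_subset_carrier proj_eq_one_iff by auto
  then show "k \<in> pre B"
    using subgroup.one_closed[OF B] by (simp add: pre_def)
qed

lemma proj_pre: "B \<subseteq> carrier Q \<Longrightarrow> proj ` pre B = B"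
  by (auto simp: pre_def carrier_Q)

lemma pre_proj:
  assumes "subgroup P G" "K \<subseteq> P"
  shows "pre (proj ` P) = P"
proof
  show "pre (proj ` P) \<subseteq> P"
  proof
    fix x assume "x \<in> pre (proj ` P)"
    then obtain p where p: "p \<in> P" "proj p = proj x" "x \<in> carrier G"
      by (auto simp: pre_def)
    then obtain k where "k \<in> K" "x = k \<otimes> p"
      using proj_eq_iff[of p x] subgroup.mem_carrier[OF assms(1)] by auto
    then show "x \<in> P"
      using p assms subgroup.m_closed by fastforce
  qed
  show "P \<subseteq> pre (proj ` P)"
    using subgroup.subset[OF assms(1)] by (auto simp: pre_def)
qed

lemma subgroup_proj:
  assumes P: "subgroup P G"
  shows "subgroup (proj ` P) Q"
proof (rule Q.subgroupI)
  show "proj ` P \<subseteq> carrier Q"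
    using subgroup.subset[OF P] by auto
  show "proj ` P \<noteq> {}"
    using subgroup.one_closed[OF P] by auto
  show "inv\<^bsub>Q\<^esub> X \<in> proj ` P" if "X \<in> proj ` P" for X
    using that subgroup.m_inv_closed[OF P] subgroup.mem_carrier[OF P] by (auto simp: proj_inv)
  show "X \<otimes>\<^bsub>Q\<^esub> Y \<in> proj ` P" if "X \<in> proj ` P" "Y \<in> proj ` P" for X Y
    using that subgroup.m_closed[OF P] subgroup.mem_carrier[OF P]
    by (auto simp: proj_mult)
qed

lemma closedin_proj:
  assumes "subgroup P G" "closedin T P" "K \<subseteq> P"
  shows "closedin QT (proj ` P)"
proof -
  have "{x \<in> topspace T. proj x \<in> proj ` P} = P"
    using pre_proj[OF assms(1,3)] by (simp add: pre_def topspace_eq_carrier)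
  moreover have "proj ` P \<subseteq> topspace QT"
    using subgroup.subset[OF assms(1)] by (auto simp: topspace_QT)
  ultimately show ?thesis
    using quotient_map_proj assms(2) unfolding quotient_map_closedin by metis
qed

lemma normal_proj:
  assumes "P \<lhd> G"
  shows "proj ` P \<lhd> Q"
  using assms subgroup_proj unfolding normal_iff_conj_by Q.normal_iff_conj_by carrier_Q
  by (auto simp: proj_conj_by subgroup.mem_carrier)

end

locale component_quotient = group_component G T M + closed_normal_quotient G T K
  for G (structure) and T :: "'a topology" and M K +
  assumes M_not_subset_K: "\<not> M \<subseteq> K"
begin

text \<open>The closures of \<open>M K\<close> and \<open>N K\<close>, which are the preimages of the new component and of a
  closed normal subgroup containing it.\<close>

definition P where "P = closed_generate G T (M \<union> K)"
definition D where "D = closed_generate G T (N \<union> K)"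

lemma MK_subset: "M \<union> K \<subseteq> carrier G" and NK_subset: "N \<union> K \<subseteq> carrier G"
  using M_subset_carrier N_subset_carrier K_subset_carrier by auto

lemma subgroup_P: "subgroup P G" and closedin_P: "closedin T P"
  and M_subset_P: "M \<subseteq> P" and K_subset_P: "K \<subseteq> P"
  using subgroup_closed_generate[OF MK_subset] closedin_closed_generate[OF MK_subset]
    closed_generate_superset[of "M \<union> K"] by (auto simp: P_def)

lemma P_subset: "\<lbrakk>subgroup H G; closedin T H; M \<subseteq> H; K \<subseteq> H\<rbrakk> \<Longrightarrow> P \<subseteq> H"
  unfolding P_def by (rule closed_generate_least) auto

lemma P_subset_carrier: "P \<subseteq> carrier G"
  using subgroup_P by (rule subgroup.subset)

lemma subgroup_D: "subgroup D G" and closedin_D: "closedin T D"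
  and N_subset_D: "N \<subseteq> D" and K_subset_D: "K \<subseteq> D"
  using subgroup_closed_generate[OF NK_subset] closedin_closed_generate[OF NK_subset]
    closed_generate_superset[of "N \<union> K"] by (auto simp: D_def)

lemma D_subset: "\<lbrakk>subgroup H G; closedin T H; N \<subseteq> H; K \<subseteq> H\<rbrakk> \<Longrightarrow> D \<subseteq> H"
  unfolding D_def by (rule closed_generate_least) auto

lemma K_conj: "\<lbrakk>g \<in> carrier G; k \<in> K\<rbrakk> \<Longrightarrow> conj_by g k \<in> K"
  by (simp add: conj_by_def inv_op_closed2)

lemma normal_D: "D \<lhd> G"
proof -
  have "conj_by g d \<in> D" if g: "g \<in> carrier G" and d: "d \<in> D" for g d
    unfolding D_def
  proof (rule conj_by_closed_generate[OF NK_subset g])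
    show "conj_by g s \<in> closed_generate G T (N \<union> K)" if "s \<in> N \<union> K" for s
      using that g K_conj normal_N N_subset_D K_subset_D
      unfolding D_def normal_iff_conj_by by blast
  qed (use d in \<open>simp add: D_def\<close>)
  then show ?thesis
    using subgroup_D by (simp add: normal_iff_conj_by)
qed

lemma K_subset_centralizer_N: "K \<subseteq> centralizer N"
  using normal_axioms closedin_K M_not_subset_K by (rule closed_normal_dichotomy)

lemma D_subset_normalizer_P: "D \<subseteq> normalizer P"
proof (rule D_subset)
  show "N \<subseteq> normalizer P"
  proof (rule subgroup_subset_normalizerI[OF subgroup_N])
    fix n p assume n: "n \<in> N" and p: "p \<in> P"
    have "n \<in> carrier G"
      using n N_subset_carrier by blast
    then show "conj_by n p \<in> P"
      using conj_by_closed_generate[OF MK_subset, of n p] n p conj_N_M K_conj M_subset_P K_subset_P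
      unfolding P_def by blast
  qed
  show "K \<subseteq> normalizer P"
    using K_subset_P subgroup_P
    by (intro subgroup_subset_normalizerI is_subgroup) (auto intro: conj_by_mem_subgroup)
qed (use P_subset_carrier closedin_P in \<open>auto intro: subgroup_normalizer closedin_normalizer\<close>)

text \<open>Here the first dichotomy is essential: \<open>K\<close> normalizes \<open>M\<close> because it centralizes it.\<close>

lemma P_subset_normalizer_M: "P \<subseteq> normalizer M"
proof (rule P_subset)
  show "M \<subseteq> normalizer M"
    using subgroup_M by (intro subgroup_subset_normalizerI) (auto intro: conj_by_mem_subgroup)
  show "K \<subseteq> normalizer M"
  proof (intro subgroup_subset_normalizerI is_subgroup)
    fix k m assume k: "k \<in> K" and m: "m \<in> M"
    then have c: "k \<in> carrier G" "m \<in> carrier G" and "commutator k m = \<one>"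
      using K_subset_centralizer_N M_subset_N M_subset_carrier by (auto simp: centralizer_mod_def)
    moreover have "conj_by k m = commutator k m \<otimes> m"
      using c by (simp add: word_simps)
    ultimately show "conj_by k m \<in> M"
      using m by simp
  qed
qed (use M_subset_carrier closedin_M in \<open>auto intro: subgroup_normalizer closedin_normalizer\<close>)

lemma closed_normal_closure_proj_P:
  "closed_normal_closure Q QT (proj ` P) \<subseteq> proj ` D"
proof (rule Q.closed_normal_closure_least)
  show "proj ` P \<subseteq> proj ` D"
    using P_subset[OF subgroup_D closedin_D] M_subset_N N_subset_D K_subset_D by blast
qed (use normal_D subgroup_D closedin_D K_subset_D in \<open>auto intro: normal_proj closedin_proj\<close>)

text \<open>Suppose the image were nilpotent of class at most two. Topological perfectness of \<open>M\<close>, used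
  once for \<open>[M, M, M] \<subseteq> K\<close> and once more for \<open>[M, M] \<subseteq> K\<close>, would then put \<open>M\<close> inside \<open>K\<close>.\<close>

lemma not_nilpotent_proj_P:
  "\<exists>X\<in>proj ` P. \<exists>Y\<in>proj ` P. \<exists>Z\<in>proj ` P. Q.commutator (Q.commutator X Y) Z \<noteq> \<one>\<^bsub>Q\<^esub>"
proof (rule ccontr)
  assume trivial: "\<not> ?thesis"
  have nil: "commutator (commutator x y) z \<in> K" if "x \<in> M" "y \<in> M" "z \<in> M" for x y z
  proof -
    have "x \<in> carrier G" "y \<in> carrier G" "z \<in> carrier G"
      using that M_subset_carrier by auto
    moreover have "Q.commutator (Q.commutator (proj x) (proj y)) (proj z) = \<one>\<^bsub>Q\<^esub>"
      using that M_subset_P trivial by blast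
    ultimately show ?thesis
      by (simp add: proj_commutator proj_eq_one_iff)
  qed
  have "M \<subseteq> centralizer_mod K M"
  proof (rule M_topologically_perfect)
    show "subgroup (centralizer_mod K M) G" "closedin T (centralizer_mod K M)"
      using M_subset_carrier normal_axioms closedin_K
      by (auto intro: subgroup_centralizer_mod closedin_centralizer_mod)
    show "commutator x y \<in> centralizer_mod K M" if "x \<in> M" "y \<in> M" for x y
      using nil that subgroup.mem_carrier[OF subgroup_M] by (simp add: centralizer_mod_def)
  qed
  then have "M \<subseteq> K"
    by (intro M_topologically_perfect[OF is_subgroup closedin_K]) (auto simp: centralizer_mod_def)
  with M_not_subset_K show False ..
qed

text \<open>Here \<open>R\<close> is the preimage of a proper closed normal subgroup of the image. Since \<open>P\<close>
  normalizes \<open>M\<close>, all \<open>[r, m]\<close> lie in \<open>R \<inter> M\<close>, which is central in \<open>N\<close>; so \<open>R\<close> centralizes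
  \<open>M\<close>. The conjugates of \<open>M\<close> outside \<open>M\<close> commute with \<open>M\<close> and with \<open>K\<close>, hence with all
  of \<open>P\<close>.\<close>

lemma N_centralizes_proper_normal_subgroup:
  assumes R: "subgroup R G" "closedin T R" "K \<subseteq> R" "R \<subseteq> P" "R \<noteq> P"
    and conj_P_R: "\<And>p r. \<lbrakk>p \<in> P; r \<in> R\<rbrakk> \<Longrightarrow> conj_by p r \<in> R"
  shows "N \<subseteq> centralizer R"
proof -
  have R_carrier: "R \<subseteq> carrier G"
    using R by (auto dest: subgroup.subset)
  have "R \<inter> M \<noteq> M"
    using P_subset[of R] R by blast
  then have RM: "R \<inter> M \<subseteq> centralizer N"
    using R subgroup_M closedin_M conj_P_R M_subset_P
    by (intro small_subgroup_central subgroups_Inter_pair closedin_Int)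
      (auto intro: conj_by_mem_subgroup)
  have R_M: "R \<subseteq> centralizer M"
  proof
    fix r assume r: "r \<in> R"
    have comm: "commutator r m \<in> R \<inter> M" if m: "m \<in> M" for m
    proof -
      have c: "r \<in> carrier G" "m \<in> carrier G"
        using r m R_carrier M_subset_carrier by auto
      have "conj_by r m \<in> M" "conj_by m (inv r) \<in> R"
        using r m R P_subset_normalizer_M conj_P_R M_subset_P
        by (auto simp: normalizer_def subgroup.m_inv_closed)
      moreover have "commutator r m = conj_by r m \<otimes> inv m"
        "commutator r m = r \<otimes> conj_by m (inv r)"
        using c by (simp_all add: word_simps)
      ultimately show ?thesis
        using r m R subgroup_M by (metis IntI subgroup.m_closed subgroup.m_inv_closed)
    qed
    show "r \<in> centralizer M"
    proof (rule mem_centralizer_M_if_commutators_central)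
      show "commutator r m \<in> centralizer M" if "m \<in> M" for m
        using comm[OF that] RM M_subset_N by (auto simp: centralizer_mod_def)
      show "commutator (commutator r m) (commutator r m') = \<one>" if "m \<in> M" "m' \<in> M" for m m'
        using comm[OF that(1)] comm[OF that(2)] RM M_subset_N by (auto simp: centralizer_mod_def)
    qed (use r R_carrier in auto)
  qed
  then have M_R: "M \<subseteq> centralizer R"
    using centralizer_sym R_carrier M_subset_carrier by blast
  show ?thesis
  proof (rule N_subset_centralizer[OF R_carrier])
    fix g m assume g: "g \<in> carrier G" and m: "m \<in> M"
    let ?c = "conj_by g m"
    have c: "?c \<in> carrier G" "?c \<in> N"
      using g m M_subset_carrier normal_N M_subset_N by (auto simp: normal_iff_conj_by)
    from conjugate_dichotomy[OF g] show "?c \<in> centralizer R"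
    proof
      assume "conj_by g ` M \<subseteq> M"
      then show ?thesis
        using m M_R by auto
    next
      assume "conj_by g ` M \<subseteq> centralizer M"
      then have "{?c} \<subseteq> centralizer M"
        using m by auto
      then have "M \<subseteq> centralizer {?c}"
        using centralizer_sym[of "{?c}" M] c M_subset_carrier by auto
      moreover have "K \<subseteq> centralizer {?c}"
        using K_subset_centralizer_N c by (auto simp: centralizer_mod_def)
      ultimately have "P \<subseteq> centralizer {?c}"
        using c by (intro P_subset subgroup_centralizer closedin_centralizer) auto
      then show ?thesis
        using centralizer_sym[of R "{?c}"] R R_carrier c by auto
    qed
  qed
qed

text \<open>Normality in the closed normal closure and centrality in it are both checked on \<open>D\<close>, whose
  image contains that closure. The subgroup \<open>D\<close> is topologically generated by \<open>N\<close> and \<open>K\<close>, and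
  commutators with \<open>K\<close> vanish in the quotient.\<close>

theorem component_proj_P: "component_of_group Q QT (proj ` P)"
  unfolding Q.component_of_group_iff
proof (intro conjI ballI allI impI not_nilpotent_proj_P)
  show "subgroup (proj ` P) Q" "closedin QT (proj ` P)"
    using subgroup_P closedin_P K_subset_P by (auto intro: subgroup_proj closedin_proj)
  show "Q.conj_by X Y \<in> proj ` P"
    if XY: "X \<in> closed_normal_closure Q QT (proj ` P)" "Y \<in> proj ` P" for X Y
  proof -
    obtain d p where dp: "X = proj d" "d \<in> D" "Y = proj p" "p \<in> P"
      using XY closed_normal_closure_proj_P by blast
    then have "conj_by d p \<in> P" "d \<in> carrier G" "p \<in> carrier G"
      using D_subset_normalizer_P P_subset_carrier by (auto simp: normalizer_def)
    then show ?thesis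
      using dp by (simp add: proj_conj_by)
  qed
next
  fix L
  assume L: "subgroup L Q \<and> closedin QT L \<and> L \<subset> proj ` P \<and>
    (\<forall>X\<in>proj ` P. \<forall>Y\<in>L. Q.conj_by X Y \<in> L)"
  define R where "R = pre L"
  have LR: "L = proj ` R"
    using L subgroup.subset[of L Q] by (auto simp: R_def proj_pre)
  have R: "subgroup R G" "closedin T R" "K \<subseteq> R"
    using L by (auto simp: R_def subgroup_pre closedin_pre K_subset_pre)
  have R_carrier: "R \<subseteq> carrier G"
    by (auto simp: R_def pre_def)
  have "R \<subseteq> pre (proj ` P)"
    using L by (auto simp: R_def pre_def)
  then have RP: "R \<subseteq> P"
    using subgroup_P K_subset_P by (simp add: pre_proj)
  have "N \<subseteq> centralizer R"
  proof (rule N_centralizes_proper_normal_subgroup[OF R RP])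
    show "R \<noteq> P"
      using L LR by auto
    show "conj_by p r \<in> R" if "p \<in> P" "r \<in> R" for p r
    proof -
      have "p \<in> carrier G" "r \<in> carrier G"
        using that P_subset_carrier R_carrier by auto
      moreover have "Q.conj_by (proj p) (proj r) \<in> L"
        using that L LR by auto
      ultimately show ?thesis
        by (simp add: R_def pre_def proj_conj_by)
    qed
  qed
  then have "N \<subseteq> centralizer_mod K R"
    using one_closed by (auto simp: centralizer_mod_def)
  moreover have "K \<subseteq> centralizer_mod K R"
    using K_subset_carrier R_carrier normal_axioms
    by (auto simp: centralizer_mod_def intro: commutator_mem_normal)
  ultimately have D: "D \<subseteq> centralizer_mod K R"
    using R_carrier normal_axioms closedin_K
    by (intro D_subset subgroup_centralizer_mod closedin_centralizer_mod) auto
  show "L \<subseteq> Q.centralizer (closed_normal_closure Q QT (proj ` P))"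
  proof
    fix X assume "X \<in> L"
    then obtain r where r: "r \<in> R" "X = proj r" "r \<in> carrier G"
      using LR R_carrier by auto
    have "Q.commutator X Y = \<one>\<^bsub>Q\<^esub>" if Y: "Y \<in> closed_normal_closure Q QT (proj ` P)" for Y
    proof -
      obtain d where d: "d \<in> D" "Y = proj d"
        using Y closed_normal_closure_proj_P by blast
      then have "commutator d r \<in> K" "d \<in> carrier G"
        using D r by (auto simp: centralizer_mod_def)
      then have "commutator r d \<in> K"
        using r is_subgroup by (blast intro: commutator_swap_mem)
      then show ?thesis
        using r d \<open>d \<in> carrier G\<close> by (simp add: proj_commutator proj_eq_one_iff)
    qed
    then show "X \<in> Q.centralizer (closed_normal_closure Q QT (proj ` P))"
      using r by (simp add: Q.centralizer_mod_def)
  qed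
qed

end

section \<open>Groups of semisimple type\<close>

text \<open>A component inside \<open>K\<close> lies in every preimage, and any other one lies in the preimage of a
  component of the quotient. Hence the preimage of the layer is a closed subgroup containing all
  components.\<close>

lemma (in closed_normal_quotient) semisimple_type_quotient:
  assumes hausdorff: "Hausdorff_space T" and semisimple: "semisimple_type G T"
  shows "semisimple_type Q QT"
proof -
  let ?S = "\<Union>{B. component_of_group Q QT B}"
  have S: "?S \<subseteq> carrier Q"
    by (auto simp: component_of_group_def dest: subgroup.subset)
  have sub: "subgroup (layer Q QT) Q" and closed: "closedin QT (layer Q QT)"
    and sup: "?S \<subseteq> layer Q QT"
    unfolding layer_def
    using S by (auto intro: Q.subgroup_closed_generate Q.closedin_closed_generate
        Q.closed_generate_superset[THEN subsetD])
  have "M \<subseteq> pre (layer Q QT)" if M: "component_of_group G T M" for M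
  proof (cases "M \<subseteq> K")
    case True
    then show ?thesis
      using K_subset_pre[OF sub] by blast
  next
    case False
    interpret component_quotient G T M K
      using hausdorff M False by unfold_locales
    have "proj ` P \<subseteq> layer Q QT"
      using component_proj_P sup by blast
    then show ?thesis
      using M_subset_P M_subset_carrier by (auto simp: pre_def)
  qed
  then have "layer G T \<subseteq> pre (layer Q QT)"
    unfolding layer_def[of G T] using sub closed
    by (intro closed_generate_least subgroup_pre closedin_pre) auto
  then have "carrier Q \<subseteq> layer Q QT"
    using semisimple by (auto simp: semisimple_type_def pre_def carrier_Q)
  then show ?thesis
    using Q.topological_group_axioms subgroup.subset[OF sub] by (auto simp: semisimple_type_def)
qed

text \<open>An element that is central modulo the center has central commutators with each component,
  so it centralizes every component and hence the layer.\<close>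

lemma (in topological_group) mem_center_if_commutators_central:
  assumes hausdorff: "Hausdorff_space T" and semisimple: "semisimple_type G T"
    and r: "r \<in> carrier G"
    and central: "\<And>x. x \<in> carrier G \<Longrightarrow> commutator r x \<in> group_center G"
  shows "r \<in> group_center G"
proof -
  have "M \<subseteq> centralizer {r}" if M: "component_of_group G T M" for M
  proof -
    interpret group_component G T M
      using hausdorff M by unfold_locales
    have comm: "commutator (commutator r m) x = \<one>" if "m \<in> M" "x \<in> carrier G" for m x
      using central[of m] that M_subset_carrier by (auto simp: group_center_eq centralizer_mod_def)
    have "r \<in> centralizer M"
    proof (rule mem_centralizer_M_if_commutators_central[OF r])
      show "commutator r m \<in> centralizer M" if "m \<in> M" for m
        using comm[OF that] that r M_subset_carrier unfolding centralizer_mod_def by auto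
      show "commutator (commutator r m) (commutator r m') = \<one>" if "m \<in> M" "m' \<in> M" for m m'
        using comm[OF that(1)] that(2) r M_subset_carrier by auto
    qed
    then show ?thesis
      using centralizer_sym[of M "{r}"] M_subset_carrier r by auto
  qed
  then have "layer G T \<subseteq> centralizer {r}"
    unfolding layer_def using r hausdorff
    by (intro closed_generate_least subgroup_centralizer closedin_centralizer) auto
  then have "carrier G \<subseteq> centralizer {r}"
    using semisimple by (simp add: semisimple_type_def)
  then show ?thesis
    using centralizer_sym[of "carrier G" "{r}"] r by (auto simp: group_center_eq)
qed

theorem theorem1p10:
  fixes G :: "('a, 'b) monoid_scheme" and T :: "'a topology" and K :: "'a set"
  assumes "topological_group G T" and "Hausdorff_space T"
    and "semisimple_type G T"
    and "K \<lhd> G" and "closedin T K"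
  shows "semisimple_type (G Mod K) (quotient_group_topology G T K) \<and>
         strict_semisimple_type (G Mod group_center G)
           (quotient_group_topology G T (group_center G))"
proof
  interpret topological_group G T
    by fact
  interpret K: closed_normal_quotient G T K
    using assms by (intro closed_normal_quotient.intro closed_normal_quotient_axioms.intro)
  show "semisimple_type (G Mod K) (quotient_group_topology G T K)"
    using assms by (intro K.semisimple_type_quotient)
  have "closedin T (group_center G)"
    unfolding group_center_eq using assms(2) by (intro closedin_centralizer) auto
  then interpret Z: closed_normal_quotient G T "group_center G"
    using normal_group_center assms
    by (intro closed_normal_quotient.intro closed_normal_quotient_axioms.intro)
  have "X = \<one>\<^bsub>Z.Q\<^esub>" if X: "X \<in> group_center Z.Q" for X
  proof -
    have X_central: "X \<in> carrier Z.Q" "\<And>Y. Y \<in> carrier Z.Q \<Longrightarrow> Z.Q.commutator X Y = \<one>\<^bsub>Z.Q\<^esub>"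
      using X unfolding Z.Q.group_center_eq Z.Q.centralizer_mod_def by blast+
    then obtain r where r: "r \<in> carrier G" "X = Z.proj r"
      unfolding Z.carrier_Q by blast
    have "commutator r x \<in> group_center G" if x: "x \<in> carrier G" for x
    proof -
      have "Z.Q.commutator (Z.proj r) (Z.proj x) = \<one>\<^bsub>Z.Q\<^esub>"
        using X_central(2) x by (simp add: r)
      then show ?thesis
        using r x by (simp add: Z.proj_commutator Z.proj_eq_one_iff)
    qed
    from mem_center_if_commutators_central[OF assms(2,3) r(1) this] have "r \<in> group_center G" .
    then show ?thesis
      using r by (simp add: Z.proj_eq_one_iff)
  qed
  moreover have "\<one>\<^bsub>Z.Q\<^esub> \<in> group_center Z.Q"
    using Z.Q.normal_group_center by (simp add: Z.Q.normal_iff_conj_by subgroup.one_closed)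
  ultimately have "group_center Z.Q = {\<one>\<^bsub>Z.Q\<^esub>}"
    by blast
  then show "strict_semisimple_type Z.Q Z.QT"
    using assms Z.semisimple_type_quotient by (simp add: strict_semisimple_type_def)
qed

end
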